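(* Let $r>0$ be a constant and fix an integer $a\ge 2$. For positive integers $k$ such that $n=rk$ is an integer, consider a sequence of $n$ independent letters, each uniformly distributed on $[a]=\{1,\dots,a\}$. Then, as $k\to\infty$ (through values for which $n=rk$ is an integer), $$\lim_{k\to\infty}\mathbb{P}(\text{the sequence is } k\text{-omni})=\begin{cases}0, & \text{if } r<a\,H(1..a),\\ 1, & \text{if } r>a\,H(1..a).\end{cases}$$
   Context: A finite sequence over $[a]$ is called $k$-omni if every one of the $a^k$ words of length $k$ over $[a]$ occurs in it as a (not necessarily contiguous) subsequence. $H(1..a)=1+\frac12+\cdots+\frac1a$. *)

theory Defs
  imports "HOL-Probability.Probability" "HOL-Library.Sublist"
begin

definition words :: "nat \<Rightarrow> nat \<Rightarrow> nat list set" where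
  "words a k = {w. length w = k \<and> set w \<subseteq> {1..a}}"

text \<open>
  The library relation \<open>subseq\<close> is the not necessarily contiguous one.
\<close>

definition omni :: "nat \<Rightarrow> nat \<Rightarrow> nat list \<Rightarrow> bool" where
  "omni a k xs \<longleftrightarrow> set xs \<subseteq> {1..a} \<and> (\<forall>w\<in>words a k. subseq w xs)"

definition random_word :: "nat \<Rightarrow> nat \<Rightarrow> nat list pmf" where
  "random_word a n = replicate_pmf n (pmf_of_set {1..a})"

definition prob_omni :: "nat \<Rightarrow> nat \<Rightarrow> nat \<Rightarrow> real" where
  "prob_omni a k n = measure_pmf.prob (random_word a n) {xs. omni a k xs}"

text \<open>
  The filter for \<open>k\<close> tending to infinity through the positive integers with \<open>r * k\<close> an integer;
  for positive \<open>r\<close> and such \<open>k\<close> one has \<open>real (nat \<lfloor>r * real k\<rfloor>) = r * real k\<close>.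
  If \<open>r\<close> is irrational there are no such \<open>k\<close>, the filter is \<open>bot\<close>, and a limit
  along it is vacuous. If \<open>r\<close> is rational the filter is proper, so limits along it are unique.
\<close>

definition admissible :: "real \<Rightarrow> nat filter" where
  "admissible r = inf at_top (principal {k. k > 0 \<and> r * real k \<in> \<int>})"

end

(*
  Cut the sequence greedily, from the right, into arches: an arch is complete as soon as all a
  letters have occurred in it.  The sequence is k-omni iff it has at least k complete arches.
  If m arches are complete and j letters of the current arch have been seen, let phi be the
  expected time that the coupon collector needs to get there,
  m a H(1..a) + a/a + a/(a-1) + ... + a/(a-j+1).  Then phi - n is a martingale whose increments
  are bounded by a, so its second moment after n letters is at most n a^2, whereas being k-omni
  means phi >= k a H(1..a).  Chebyshev's inequality finishes the proof.
*)
theory Submission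
  imports Defs
begin

section \<open>Arches\<close>

text \<open>
  The number of complete arches, and the set of letters of the current incomplete arch.
  Reading from the right, rather than from the left as usual, matches the recursion on lists
  and gives the same number of arches.
\<close>

primrec arches :: "nat \<Rightarrow> nat list \<Rightarrow> nat \<times> nat set" where
  "arches a [] = (0, {})"
| "arches a (x # xs) =
    (case arches a xs of (m, C) \<Rightarrow>
      if insert x C = {1..a} then (Suc m, {}) else (m, insert x C))"

text \<open>A full arch is reset to the empty set at once, and \<open>a \<ge> 1\<close> makes the
  empty set a proper subset.\<close>

lemma arches_psubset:
  assumes "a \<ge> 1" "set xs \<subseteq> {1..a}" "arches a xs = (m, C)"
  shows "C \<subset> {1..a}"
  using assms(2,3)
proof (induction xs arbitrary: m C)
  case Nil
  with assms(1) show ?case by auto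
next
  case (Cons x xs)
  obtain m' C' where "arches a xs = (m', C')" by fastforce
  with Cons assms(1) show ?case by (fastforce split: if_splits)
qed

text \<open>Every complete arch supplies one letter of the word. The current arch, which lies
  furthest left, can serve the first letter; allowing this one extra letter is what carries the
  induction.\<close>

lemma subseq_if_arches:
  assumes "arches a xs = (m, C)" "set w \<subseteq> {1..a}"
    and "length w \<le> m \<or> length w = Suc m \<and> hd w \<in> C"
  shows "subseq w xs"
  using assms
proof (induction xs arbitrary: m C w)
  case Nil
  then show ?case by auto
next
  case (Cons x xs)
  obtain m' C' where A: "arches a xs = (m', C')" by fastforce
  show ?case
  proof (cases w)
    case Nil
    then show ?thesis by simp
  next
    case (Cons c v)
    have "subseq v xs" if "length v \<le> m'"
      using Cons.IH[OF A, of v] Cons.prems(2) that \<open>w = c # v\<close> by simp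
    moreover have "subseq (c # v) xs" if "Suc (length v) \<le> m' \<or> length v = m' \<and> c \<in> C'"
      using Cons.IH[OF A, of "c # v"] Cons.prems(2) that \<open>w = c # v\<close> by simp
    \<comment> \<open>If \<open>x\<close> closes an arch, \<open>insert x C'\<close> is the whole
      alphabet, so \<open>c\<close> lies in it for free.\<close>
    moreover have "Suc (length v) \<le> m' \<or> length v = m' \<and> c \<in> insert x C'"
      using Cons.prems A \<open>w = c # v\<close> by (auto split: if_splits)
    ultimately show ?thesis
      using \<open>w = c # v\<close> by auto
  qed
qed

text \<open>The word \<open>w\<close> lists the letters that close the arches. Each occurs in its
  arch only at the left end, so embedding it uses up the arch. The induction needs one
  \<open>w\<close> that defeats all \<open>c\<close> outside \<open>C\<close> at once.\<close>

lemma not_subseq_if_arches: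
  assumes "a \<ge> 1" "set xs \<subseteq> {1..a}" "arches a xs = (m, C)"
  shows "\<exists>w\<in>words a m. \<forall>c. c \<notin> C \<longrightarrow> \<not> subseq (c # w) xs"
  using assms(2,3)
proof (induction xs arbitrary: m C)
  case Nil
  then show ?case by (auto simp: words_def)
next
  case (Cons x xs)
  obtain m' C' where A: "arches a xs = (m', C')" by fastforce
  have sub: "C' \<subset> {1..a}"
    using arches_psubset[OF assms(1) _ A] Cons.prems by simp
  obtain w where w: "w \<in> words a m'" "\<And>c. c \<notin> C' \<Longrightarrow> \<not> subseq (c # w) xs"
    using Cons.IH[OF _ A] Cons.prems by auto
  show ?case
  proof (cases "insert x C' = {1..a}")
    case True
    then have "x \<notin> C'" using sub by (auto simp: insert_absorb)
    then have "\<not> subseq (x # w) xs" by (rule w)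
    \<comment> \<open>The leading \<open>x\<close> can serve only as \<open>c\<close>, so
      \<open>x # w\<close> would have to fit into \<open>xs\<close>.\<close>
    then have "\<not> subseq (c # x # w) (x # xs)" for c
      using subseq_Cons'[of c "x # w" xs] by auto
    moreover have "x # w \<in> words a m"
      using w(1) True A Cons.prems by (auto simp: words_def)
    ultimately show ?thesis by blast
  next
    case False
    then have "m = m'" "C = insert x C'" using A Cons.prems by auto
    with w show ?thesis by auto
  qed
qed

lemma omni_iff_arches:
  assumes "a \<ge> 1" "set xs \<subseteq> {1..a}"
  shows "omni a k xs \<longleftrightarrow> k \<le> fst (arches a xs)"
proof -
  obtain m C where A: "arches a xs = (m, C)" by fastforce
  have "omni a k xs" if "k \<le> m"
    using that assms(2) subseq_if_arches[OF A] by (auto simp: omni_def words_def)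
  moreover have "\<not> omni a k xs" if "m < k"
  proof -
    obtain c where c: "c \<in> {1..a}" "c \<notin> C"
      using psubset_imp_ex_mem[OF arches_psubset[OF assms A]] by blast
    obtain w where w: "w \<in> words a m" "\<not> subseq (c # w) xs"
      using not_subseq_if_arches[OF assms A] c by auto
    \<comment> \<open>A missing word of length \<open>Suc m\<close> is padded to length
      \<open>k\<close>; any word containing it is missing too.\<close>
    define v where "v = (c # w) @ replicate (k - Suc m) c"
    have "v \<in> words a k"
      using w(1) c(1) that by (auto simp: v_def words_def)
    moreover have "\<not> subseq v xs"
    proof
      assume "subseq v xs"
      moreover have "subseq (c # w) v"
        unfolding v_def by (intro prefix_imp_subseq) simp
      ultimately show False
        using w(2) subseq_order.order_trans by blast
    qed
    ultimately show ?thesis by (auto simp: omni_def)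
  qed
  ultimately show ?thesis using A by (cases "k \<le> m") auto
qed

section \<open>The martingale\<close>

definition collector_time :: "nat \<Rightarrow> nat \<Rightarrow> real" where
  "collector_time a j = (\<Sum>i<j. real a / real (a - i))"

definition potential :: "nat \<Rightarrow> nat list \<Rightarrow> real" where
  "potential a xs =
    (case arches a xs of (m, C) \<Rightarrow> real m * collector_time a a + collector_time a (card C))"

lemma collector_time_full: "collector_time a a = real a * harm a"
proof -
  have "collector_time a a = (\<Sum>i<a. real a / real (Suc i))"
    unfolding collector_time_def
    by (subst sum.nat_diff_reindex[symmetric]) (auto intro!: sum.cong simp: Suc_diff_Suc)
  also have "\<dots> = real a * harm a"
    unfolding harm_def sum_distrib_left
    by (rule sum.reindex_bij_witness[of _ "\<lambda>i. i - 1" Suc]) (auto simp: field_simps)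
  finally show ?thesis .
qed

lemma collector_time_less:
  assumes "i < j" "j \<le> a"
  shows "collector_time a i < collector_time a j"
  unfolding collector_time_def
  by (rule sum_strict_mono2[of _ _ i]) (use assms in auto)

text \<open>The incomplete arch counts for strictly less than a full one, so the potential is at
  least \<open>m * H\<close> and less than \<open>(m + 1) * H\<close>, where
  \<open>H = collector_time a a\<close>.\<close>

lemma potential_ge_iff:
  assumes "a \<ge> 1" "set xs \<subseteq> {1..a}"
  shows "real k * (real a * harm a) \<le> potential a xs \<longleftrightarrow> k \<le> fst (arches a xs)"
proof -
  obtain m C where A: "arches a xs = (m, C)" by fastforce
  let ?H = "collector_time a a"
  have "C \<subset> {1..a}" by (rule arches_psubset[OF assms A])
  then have "card C < a" using psubset_card_mono[of "{1..a}" C] by simp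
  then have less: "collector_time a (card C) < ?H" by (intro collector_time_less) auto
  have nonneg: "0 \<le> collector_time a (card C)" by (simp add: collector_time_def sum_nonneg)
  have pot: "potential a xs = real m * ?H + collector_time a (card C)"
    using A by (simp add: potential_def)
  show ?thesis
  proof (cases "k \<le> m")
    case True
    then have "real k * ?H \<le> real m * ?H"
      using less nonneg by (intro mult_right_mono) auto
    then show ?thesis
      using True A pot nonneg by (simp add: collector_time_full[symmetric])
  next
    case False
    then have "real (Suc m) * ?H \<le> real k * ?H"
      using less nonneg by (intro mult_right_mono) auto
    then show ?thesis
      using False A pot less by (simp add: collector_time_full[symmetric] distrib_right)
  qed
qed

text \<open>A new letter earns the mean waiting time of its collection stage. Closing an arch causes
  no jump, since the full collection time turns into one more complete arch; hence a single
  formula.\<close>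

lemma potential_Cons:
  assumes "a \<ge> 1" "set xs \<subseteq> {1..a}" "x \<in> {1..a}" "arches a xs = (m, C)"
  shows "potential a (x # xs) =
    potential a xs + (if x \<in> C then 0 else real a / real (a - card C))"
proof -
  have sub: "C \<subset> {1..a}" by (rule arches_psubset[OF assms(1,2,4)])
  then have fin: "finite C" using finite_subset by blast
  show ?thesis
  proof (cases "x \<in> C")
    case True
    then show ?thesis using assms(4) sub by (auto simp: potential_def insert_absorb)
  next
    case False
    then have step: "collector_time a (card (insert x C)) =
        collector_time a (card C) + real a / real (a - card C)"
      using fin by (simp add: collector_time_def)
    show ?thesis
    proof (cases "insert x C = {1..a}")
      case True
      then have "collector_time a a = collector_time a (card C) + real a / real (a - card C)"
        using step by simp
      moreover have "potential a (x # xs) = real m * collector_time a a + collector_time a a"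
        using True assms(4) by (simp add: potential_def collector_time_def distrib_right)
      ultimately show ?thesis using False assms(4) by (simp add: potential_def)
    next
      case F: False
      with step False assms(4) show ?thesis by (simp add: potential_def)
    qed
  qed
qed

text \<open>One step of the martingale, conditioned on \<open>xs\<close>: the increment
  \<open>D\<close> has mean zero, so the cross term of the square vanishes.\<close>

lemma second_moment_step:
  assumes "a \<ge> 1" "set xs \<subseteq> {1..a}"
  shows "(\<Sum>x\<in>{1..a}. (potential a (x # xs) - real (length (x # xs)))\<^sup>2) / real a
    \<le> (potential a xs - real (length xs))\<^sup>2 + (real a)\<^sup>2"
proof -
  obtain m C where A: "arches a xs = (m, C)" by fastforce
  have sub: "C \<subset> {1..a}" by (rule arches_psubset[OF assms A])
  then have less: "card C < a" using psubset_card_mono[of "{1..a}" C] by simp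
  define N where "N = potential a xs - real (length xs)"
  define D where "D x = (if x \<in> C then 0 else real a / real (a - card C)) - 1" for x
  \<comment> \<open>Each of the \<open>a - card C\<close> unseen letters earns
    \<open>a / (a - card C)\<close>, in total \<open>a\<close>; this balances the loss of 1 at each
    of the \<open>a\<close> letters.\<close>
  have "(\<Sum>x\<in>{1..a}. if x \<in> C then 0 else real a / real (a - card C))
      = (\<Sum>x\<in>{1..a} - C. real a / real (a - card C))"
    by (rule sum.mono_neutral_cong_right) auto
  also have "\<dots> = real (a - card C) * (real a / real (a - card C))"
    using sub finite_subset[of C "{1..a}"] by (subst sum_constant) (auto simp: card_Diff_subset)
  also have "\<dots> = real a" using less by simp
  finally have sum_D: "(\<Sum>x\<in>{1..a}. D x) = 0" by (simp add: D_def sum_subtractf)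
  \<comment> \<open>The current arch misses some letter, so the divisor is at least 1 and no gain
    exceeds \<open>a\<close>.\<close>
  have "real a / real (a - card C) \<le> real a / 1"
    using less by (intro divide_left_mono) auto
  moreover have "0 \<le> real a / real (a - card C)" by simp
  ultimately have "\<bar>D x\<bar> \<le> real a" for x
    using assms(1) by (auto simp: D_def abs_le_iff simp del: divide_nonneg_nonneg)
  then have D2: "(D x)\<^sup>2 \<le> (real a)\<^sup>2" for x
    by (metis abs_ge_zero power2_abs power_mono)
  have "(\<Sum>x\<in>{1..a}. (potential a (x # xs) - real (length (x # xs)))\<^sup>2)
      = (\<Sum>x\<in>{1..a}. (N + D x)\<^sup>2)"
    by (rule sum.cong) (auto simp: potential_Cons[OF assms _ A] N_def D_def algebra_simps)
  also have "\<dots> = real a * N\<^sup>2 + 2 * N * (\<Sum>x\<in>{1..a}. D x) + (\<Sum>x\<in>{1..a}. (D x)\<^sup>2)"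
    by (simp add: power2_sum sum.distrib sum_distrib_left algebra_simps)
  also have "\<dots> \<le> real a * N\<^sup>2 + real a * (real a)\<^sup>2"
    using sum_mono[of "{1..a}" "\<lambda>x. (D x)\<^sup>2" "\<lambda>_. (real a)\<^sup>2"] D2 sum_D by simp
  also have "\<dots> = real a * (N\<^sup>2 + (real a)\<^sup>2)" by (simp add: algebra_simps)
  finally show ?thesis
    using assms(1) by (simp add: N_def pos_divide_le_eq mult.commute)
qed

section \<open>Second moment and Chebyshev's inequality\<close>

lemma set_random_word:
  assumes "a \<ge> 1"
  shows "set_pmf (random_word a n) = words a n"
  using assms by (auto simp: random_word_def set_replicate_pmf words_def in_lists_conv_set)

lemma finite_words: "finite (words a n)"
  using finite_lists_length_eq[of "{1..a}" n] by (simp add: words_def conj_commute)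

lemma second_moment_le:
  assumes "a \<ge> 1"
  shows "measure_pmf.expectation (random_word a n) (\<lambda>xs. (potential a xs - real n)\<^sup>2)
    \<le> real n * (real a)\<^sup>2"
proof (induction n)
  case 0
  then show ?case by (simp add: random_word_def potential_def collector_time_def)
next
  case (Suc n)
  let ?f = "\<lambda>xs. potential a xs - real (length xs)"
  have int: "integrable (measure_pmf (random_word a n)) g" for g :: "nat list \<Rightarrow> real"
    by (rule integrable_measure_pmf_finite) (simp add: set_random_word[OF assms] finite_words)
  \<comment> \<open>On the support the length is \<open>n\<close>; the form with
    \<open>length xs\<close> is the one that \<open>second_moment_step\<close> handles.\<close>
  have len: "measure_pmf.expectation (random_word a n) (\<lambda>xs. (potential a xs - real n)\<^sup>2)
      = measure_pmf.expectation (random_word a n) (\<lambda>xs. (?f xs)\<^sup>2)" for n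
    by (intro integral_cong_AE)
      (auto simp: AE_measure_pmf_iff set_random_word[OF assms] words_def)
  \<comment> \<open>Since arches are read from the right, the newest letter is the head of the list,
    drawn independently of the tail.\<close>
  have bind: "random_word a (Suc n) =
      pmf_of_set {1..a} \<bind> (\<lambda>x. map_pmf (Cons x) (random_word a n))"
    by (simp add: random_word_def map_pmf_def)
  have "measure_pmf.expectation (random_word a (Suc n)) (\<lambda>xs. (?f xs)\<^sup>2)
      = (\<Sum>x\<in>{1..a}. measure_pmf.expectation (random_word a n) (\<lambda>xs. (?f (x # xs))\<^sup>2)) / real a"
    unfolding bind using assms
    by (subst pmf_expectation_bind_pmf_of_set)
      (auto simp: set_random_word finite_words sum_divide_distrib divide_inverse mult.commute sum_distrib_left)
  also have "\<dots> = measure_pmf.expectation (random_word a n)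
      (\<lambda>xs. (\<Sum>x\<in>{1..a}. (?f (x # xs))\<^sup>2) / real a)"
    by (subst Bochner_Integration.integral_sum[symmetric]) (auto simp: int)
  also have "\<dots> \<le> measure_pmf.expectation (random_word a n) (\<lambda>xs. (?f xs)\<^sup>2 + (real a)\<^sup>2)"
    using second_moment_step[OF assms]
    by (intro integral_mono_AE int)
      (auto simp: AE_measure_pmf_iff set_random_word[OF assms] words_def)
  also have "\<dots> = measure_pmf.expectation (random_word a n) (\<lambda>xs. (?f xs)\<^sup>2) + (real a)\<^sup>2"
    by (subst Bochner_Integration.integral_add) (auto simp: int)
  also have "\<dots> \<le> real (Suc n) * (real a)\<^sup>2"
    using Suc.IH by (simp add: len algebra_simps)
  finally show ?case by (simp only: len)
qed

lemma prob_deviation_le: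
  assumes "a \<ge> 1" "t > 0"
  shows "measure_pmf.prob (random_word a n) {xs. \<bar>potential a xs - real n\<bar> \<ge> t}
    \<le> real n * (real a)\<^sup>2 / t\<^sup>2"
proof -
  have "measure_pmf.prob (random_word a n) {xs. \<bar>potential a xs - real n\<bar> \<ge> t}
      \<le> measure_pmf.expectation (random_word a n) (\<lambda>xs. (potential a xs - real n)\<^sup>2) / t\<^sup>2"
    using measure_pmf.second_moment_method[of "\<lambda>xs. potential a xs - real n" "random_word a n" t]
      assms by (simp add: integrable_measure_pmf_finite set_random_word finite_words)
  also have "\<dots> \<le> real n * (real a)\<^sup>2 / t\<^sup>2"
    by (intro divide_right_mono second_moment_le assms) simp
  finally show ?thesis .
qed

section \<open>The threshold\<close>

text \<open>The two events agree on words over the alphabet, and these carry all the mass.\<close>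

lemma prob_omni_eq:
  assumes "a \<ge> 1"
  shows "prob_omni a k n =
    measure_pmf.prob (random_word a n) {xs. real k * (real a * harm a) \<le> potential a xs}"
  unfolding prob_omni_def
  by (intro measure_pmf.finite_measure_eq_AE)
    (auto simp: AE_measure_pmf_iff set_random_word[OF assms] words_def
      omni_iff_arches[OF assms] potential_ge_iff[OF assms])

text \<open>Below the threshold, being omni forces the potential to exceed \<open>n\<close> by at
  least the gap \<open>real k * (real a * harm a) - real n\<close>.\<close>

lemma prob_omni_le:
  assumes "a \<ge> 1" "real n < real k * (real a * harm a)"
  shows "prob_omni a k n \<le> real n * (real a)\<^sup>2 / (real k * (real a * harm a) - real n)\<^sup>2"
proof -
  have "prob_omni a k n \<le> measure_pmf.prob (random_word a n)
      {xs. \<bar>potential a xs - real n\<bar> \<ge> real k * (real a * harm a) - real n}"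
    unfolding prob_omni_eq[OF assms(1)] by (intro measure_pmf.finite_measure_mono) auto
  also note prob_deviation_le[OF assms(1)]
  finally show ?thesis using assms(2) by simp
qed

text \<open>Above the threshold, failing to be omni forces a downward deviation; squaring makes the
  bound the same.\<close>

lemma prob_omni_ge:
  assumes "a \<ge> 1" "real k * (real a * harm a) < real n"
  shows "1 - prob_omni a k n \<le> real n * (real a)\<^sup>2 / (real k * (real a * harm a) - real n)\<^sup>2"
proof -
  have "1 - prob_omni a k n = measure_pmf.prob (random_word a n)
      (- {xs. real k * (real a * harm a) \<le> potential a xs})"
    unfolding prob_omni_eq[OF assms(1)]
    using measure_pmf.prob_compl[of "{xs. real k * (real a * harm a) \<le> potential a xs}" "random_word a n"]
    by (simp add: Compl_eq_Diff_UNIV)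
  also have "\<dots> \<le> measure_pmf.prob (random_word a n)
      {xs. \<bar>potential a xs - real n\<bar> \<ge> real n - real k * (real a * harm a)}"
    by (intro measure_pmf.finite_measure_mono) auto
  also note prob_deviation_le[OF assms(1)]
  finally show ?thesis using assms(2) by (simp add: power2_commute)
qed

lemma eventually_admissible:
  assumes "r > 0"
  shows "eventually (\<lambda>k. k > 0 \<and> real (nat \<lfloor>r * real k\<rfloor>) = r * real k) (admissible r)"
  unfolding admissible_def eventually_inf_principal
  using assms by (auto intro!: always_eventually elim!: Ints_cases)

text \<open>The numerator is linear in \<open>k\<close> and the denominator quadratic. The limit is
  taken over all \<open>k\<close>, then restricted to the admissible ones.\<close>

lemma deviation_bound_tendsto_0:
  fixes r h c :: real
  assumes "r \<noteq> h"
  shows "((\<lambda>k. (r * real k) * c / (real k * h - r * real k)\<^sup>2) \<longlongrightarrow> 0) (admissible r)"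
proof (rule tendsto_mono)
  show "admissible r \<le> sequentially" by (simp add: admissible_def)
  have "(\<lambda>k. r * c / (h - r)\<^sup>2 * inverse (real k)) \<longlonglongrightarrow> r * c / (h - r)\<^sup>2 * 0"
    by (intro tendsto_intros lim_inverse_n)
  \<comment> \<open>At \<open>k = 0\<close> both sides are 0 by the convention for division by
    zero.\<close>
  moreover have "r * c / (h - r)\<^sup>2 * inverse (real k)
      = (r * real k) * c / (real k * h - r * real k)\<^sup>2" for k
  proof -
    have "real k * h - r * real k = real k * (h - r)" by (simp add: algebra_simps)
    with assms show ?thesis by (simp add: power2_eq_square divide_simps)
  qed
  ultimately show "(\<lambda>k. (r * real k) * c / (real k * h - r * real k)\<^sup>2) \<longlonglongrightarrow> 0"
    by simp
qed

theorem theorem4p1: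
  fixes r :: real and a :: nat
  assumes "r > 0" and "a \<ge> 2"
  shows "(r < real a * harm a \<longrightarrow>
            ((\<lambda>k. prob_omni a k (nat \<lfloor>r * real k\<rfloor>)) \<longlongrightarrow> 0) (admissible r)) \<and>
         (r > real a * harm a \<longrightarrow>
            ((\<lambda>k. prob_omni a k (nat \<lfloor>r * real k\<rfloor>)) \<longlongrightarrow> 1) (admissible r))"
proof (intro conjI impI)
  let ?h = "real a * harm a"
  let ?b = "\<lambda>k. (r * real k) * (real a)\<^sup>2 / (real k * ?h - r * real k)\<^sup>2"
  have a: "a \<ge> 1" using assms(2) by simp
  have adm: "eventually (\<lambda>k. k > 0 \<and> real (nat \<lfloor>r * real k\<rfloor>) = r * real k) (admissible r)"
    using assms(1) by (rule eventually_admissible)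
  {
    assume less: "r < ?h"
    then have lim: "(?b \<longlongrightarrow> 0) (admissible r)" by (intro deviation_bound_tendsto_0) simp
    show "((\<lambda>k. prob_omni a k (nat \<lfloor>r * real k\<rfloor>)) \<longlongrightarrow> 0) (admissible r)"
    proof (rule tendsto_sandwich[OF _ _ tendsto_const lim])
      show "\<forall>\<^sub>F k in admissible r. 0 \<le> prob_omni a k (nat \<lfloor>r * real k\<rfloor>)"
        by (simp add: prob_omni_def)
      show "\<forall>\<^sub>F k in admissible r. prob_omni a k (nat \<lfloor>r * real k\<rfloor>) \<le> ?b k"
        using adm
      proof eventually_elim
        case (elim k)
        \<comment> \<open>Strictness uses \<open>k > 0\<close>, which holds for admissible
          \<open>k\<close>.\<close>
        then have "r * real k < real k * ?h" using less by simp
        with elim prob_omni_le[OF a, of "nat \<lfloor>r * real k\<rfloor>" k] show ?case by simp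
      qed
    qed
  }
  {
    assume less: "r > ?h"
    then have "(?b \<longlongrightarrow> 0) (admissible r)" by (intro deviation_bound_tendsto_0) simp
    then have lim: "((\<lambda>k. 1 - ?b k) \<longlongrightarrow> 1) (admissible r)"
      using tendsto_diff[OF tendsto_const[of 1]] by fastforce
    show "((\<lambda>k. prob_omni a k (nat \<lfloor>r * real k\<rfloor>)) \<longlongrightarrow> 1) (admissible r)"
    proof (rule tendsto_sandwich[OF _ _ lim tendsto_const])
      show "\<forall>\<^sub>F k in admissible r. prob_omni a k (nat \<lfloor>r * real k\<rfloor>) \<le> 1"
        by (simp add: prob_omni_def)
      show "\<forall>\<^sub>F k in admissible r. 1 - ?b k \<le> prob_omni a k (nat \<lfloor>r * real k\<rfloor>)"
        using adm
      proof eventually_elim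
        case (elim k)
        then have "real k * ?h < r * real k" using less by simp
        with elim prob_omni_ge[OF a, of k "nat \<lfloor>r * real k\<rfloor>"] show ?case by simp
      qed
    qed
  }
qed

end
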